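(* Let $t\geq 15$ be an integer and $0<p\leq p_0(t)$, where $p_0(t)=\frac{2}{\sqrt{4t+9}-1}$. Then there exist constants $\epsilon_0=\epsilon_0(p,t)>0$ and $C=C(p,t)>0$ (depending only on $p$ and $t$) such that the following holds: for every $0<\epsilon<\epsilon_0$, every integer $n\ge t$, and every shifted $3$-wise $t$-intersecting family $\mathcal{G}\subset 2^{[n]}$ with $\mu_p(\mathcal{G})=p^t-\epsilon$, we have $$\mu_p(\mathcal{F}\triangle\mathcal{G})<C\epsilon$$ for some $\mathcal{F}\in\{\mathcal{F}_0^t,\mathcal{F}_1^t\}$.
   Context: $[n]=\{1,2,\ldots,n\}$ and $2^{[n]}$ is its power set. A family $\mathcal{G}\subset 2^{[n]}$ is $3$-wise $t$-intersecting if $|G_1\cap G_2\cap G_3|\geq t$ for all $G_1,G_2,G_3\in\mathcal{G}$ (not necessarily distinct). For $0<p<1$ and $q=1-p$, the $p$-biased measure is $\mu_p(\mathcal{G})=\sum_{G\in\mathcal{G}}p^{|G|}q^{n-|G|}$. A family $\mathcal{F}\subset 2^{[n]}$ is shifted if $(F\setminus\{j\})\cup\{i\}\in\mathcal{F}$ whenever $F\in\mathcal{F}$ and $1\le i<j\le n$ satisfy $\{i,j\}\cap F=\{j\}$. For integers $0\le s\le\lfloor\frac{n-t}{3}\rfloor$, $\mathcal{F}_s^t=\mathcal{F}_s^t(n)=\{F\in 2^{[n]}: |F\cap[t+3s]|\geq t+2s\}$; thus $\mathcal{F}_1^t$ is defined only when $n\ge t+3$, and the alternative $\mathcal F=\mathcal{F}_1^t$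 does not occur otherwise. The symmetric difference is $\mathcal{F}\triangle\mathcal{G}=(\mathcal{F}\cup\mathcal{G})\setminus(\mathcal{F}\cap\mathcal{G})$. *)

theory Defs
  imports Complex_Main
begin

definition three_wise_intersecting :: "nat \<Rightarrow> nat set set \<Rightarrow> bool" where
  "three_wise_intersecting t \<G> \<longleftrightarrow>
     (\<forall>G1\<in>\<G>. \<forall>G2\<in>\<G>. \<forall>G3\<in>\<G>. card (G1 \<inter> G2 \<inter> G3) \<ge> t)"

text \<open>Meant for families of subsets of \<open>{1..n}\<close>, so that \<open>n - card G\<close> is not truncated.\<close>

definition biased_measure :: "nat \<Rightarrow> real \<Rightarrow> nat set set \<Rightarrow> real" where
  "biased_measure n p \<G> = (\<Sum>G\<in>\<G>. p ^ card G * (1 - p) ^ (n - card G))"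

definition shifted :: "nat \<Rightarrow> nat set set \<Rightarrow> bool" where
  "shifted n \<F> \<longleftrightarrow>
     (\<forall>F\<in>\<F>. \<forall>i j. 1 \<le> i \<and> i < j \<and> j \<le> n \<and> {i, j} \<inter> F = {j} \<longrightarrow> (F - {j}) \<union> {i} \<in> \<F>)"

text \<open>The definition is only meant for \<open>t + 3 * s \<le> n\<close>; users have to state this side
  condition explicitly.\<close>

definition frankl_family :: "nat \<Rightarrow> nat \<Rightarrow> nat \<Rightarrow> nat set set" where
  "frankl_family n t s = {F. F \<subseteq> {1..n} \<and> card (F \<inter> {1..t + 3 * s}) \<ge> t + 2 * s}"

definition p0 :: "nat \<Rightarrow> real" where
  "p0 t = 2 / (sqrt (4 * real t + 9) - 1)"

end

theory Submission
  imports Defs "HOL-Analysis.Complex_Transcendental"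
begin

text \<open>
  Write \<open>q = 1 - p\<close>. If \<open>\<G>\<close> is contained in the Frankl family with \<open>s = 0\<close> or \<open>s = 1\<close>, whose measure is at
  most \<open>p ^ t\<close> because \<open>p \<le> p0 t\<close>, then the symmetric difference has measure at most \<open>\<epsilon>\<close>. So the
  theorem amounts to a gap: a shifted 3-wise \<open>t\<close>-intersecting family contained in neither of them has
  measure at most \<open>99/100 * p ^ t\<close>, uniformly in \<open>n\<close> (\<open>measure_gap\<close>).

  Shifting turns the intersection property into an inequality about counts of missing elements: for
  \<open>A\<close>, \<open>B\<close>, \<open>C\<close> in \<open>\<G>\<close> there is \<open>k \<ge> t\<close> such that up to \<open>k\<close> the three sets miss at most \<open>k - t\<close>
  elements in total (\<open>three_missed_bound\<close>). With \<open>A = B = C\<close> this says that the random walk with steps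
  \<open>1\<close> (element present) and \<open>-2\<close> (element missing) reaches height \<open>t\<close>. The probability of reaching
  height \<open>u\<close> is at most \<open>b ^ u\<close>, where \<open>b\<close> in \<open>(0, 1)\<close> solves \<open>b = p + q * b ^ 3\<close>
  (\<open>prob_hits_le\<close>). The threshold on \<open>p\<close> makes \<open>b ^ t \<le> exp 1 * p ^ t\<close>
  (\<open>hitting_root_power_le\<close>), and \<open>t \<ge> 15\<close> makes \<open>b \<le> 3/10\<close>. Reaching height \<open>t\<close> alone is thus not rare
  enough, but together with a further event of probability about \<open>b\<close> it is.

  If every walk in \<open>\<G>\<close> is at height at least \<open>t\<close> at two times, this costs the factor \<open>p + q * b\<^sup>2\<close>
  (\<open>prob_hits_twice_le\<close>). Otherwise some \<open>F\<close> in \<open>\<G>\<close> is that high only once, at a time \<open>t + 3 * s\<close>, and the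
  triple inequality for \<open>F\<close>, \<open>F\<close>, \<open>A\<close> forces every \<open>A\<close> in \<open>\<G>\<close> either to lie in the Frankl family with
  this \<open>s\<close> or to reach height \<open>t + 2\<close> (\<open>hits_at_common_position\<close>). The latter has probability at most \<open>b ^ (t + 2)\<close>,
  which leaves ample room. For \<open>s \<ge> 2\<close> the Frankl family is too light, since the measures decrease in
  \<open>s\<close>. For \<open>s \<le> 1\<close> some \<open>A0\<close> in \<open>\<G>\<close> lies outside the Frankl family, and the triple inequality for
  \<open>B\<close>, \<open>B\<close>, \<open>A0\<close> makes almost all \<open>B\<close> inside it satisfy one further, unlikely, hitting condition.
\<close>

section \<open>Counting missing elements\<close>

definition missed :: "nat \<Rightarrow> nat \<Rightarrow> nat set \<Rightarrow> nat" where
  "missed a k A = card ({a<..k} - A)"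

lemma missed_self [simp]: "missed a a A = 0"
  by (simp add: missed_def)

lemma missed_mono: "k \<le> l \<Longrightarrow> missed a k A \<le> missed a l A"
  unfolding missed_def by (intro card_mono) auto

lemma missed_split:
  assumes "a \<le> b" "b \<le> c"
  shows "missed a c A = missed a b A + missed b c A"
proof -
  have "{a<..c} - A = ({a<..b} - A) \<union> ({b<..c} - A)" using assms by auto
  then show ?thesis unfolding missed_def by (subst card_Un_disjoint[symmetric]) auto
qed

lemma missed_single: "missed a (Suc a) A = (if Suc a \<in> A then 0 else 1)"
proof -
  have "{a<..Suc a} = {Suc a}" by auto
  then show ?thesis by (simp add: missed_def insert_Diff_if)
qed

lemma missed_le: "missed a k A \<le> k - a"
proof -
  have "card ({a<..k} - A) \<le> card {a<..k}" by (intro card_mono) auto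
  then show ?thesis by (simp add: missed_def)
qed

lemma missed_Int: "{a<..k} \<subseteq> S \<Longrightarrow> missed a k (A \<inter> S) = missed a k A"
  unfolding missed_def by (intro arg_cong[where f = card]) auto

lemma missed_insert: "x \<le> a \<Longrightarrow> missed a k (insert x A) = missed a k A"
  unfolding missed_def by (intro arg_cong[where f = card]) auto

section \<open>Triples in a shifted family\<close>

text \<open>
  If \<open>A \<subseteq> B\<close> fails, let \<open>j\<close> be the least element of \<open>A - B\<close>. Up to \<open>j\<close> the set \<open>B\<close> misses
  no more than \<open>A\<close>, so some \<open>i < j\<close> lies in \<open>B - A\<close>, and replacing \<open>j\<close> by \<open>i\<close> in \<open>A\<close> is a legal
  shift. By minimality of \<open>j\<close>, from \<open>i\<close> up to \<open>j\<close> the set \<open>A\<close> misses strictly more than \<open>B\<close>, so the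
  shift preserves the domination while \<open>A - B\<close> loses an element. The conclusion stops at a subset
  of \<open>B\<close> because \<open>\<G>\<close> need not be closed under supersets; a subset is all that upper bounds on
  intersections require.
\<close>

lemma shifted_dominance:
  assumes sh: "shifted n \<G>" and sub: "\<G> \<subseteq> Pow {1..n}"
    and "A \<in> \<G>" "B \<subseteq> {1..n}" "\<And>k. k \<le> n \<Longrightarrow> missed 0 k B \<le> missed 0 k A"
  shows "\<exists>D\<in>\<G>. D \<subseteq> B"
  using assms(3-)
proof (induction "card (A - B)" arbitrary: A rule: less_induct)
  case less
  show ?case
  proof (cases "A \<subseteq> B")
    case True
    with less.prems show ?thesis by blast
  next
    case False
    have An: "A \<subseteq> {1..n}" using less.prems sub by auto
    then have finA: "finite A" using finite_subset by blast
    define j where "j = (LEAST j. j \<in> A - B)"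
    from False obtain j0 where "j0 \<in> A - B" by blast
    then have j: "j \<in> A - B" unfolding j_def by (rule LeastI)
    have jmin: "x \<in> B" if "x \<in> A" "x < j" for x
    proof (rule ccontr)
      assume "x \<notin> B"
      with that have "x \<in> A - B" by simp
      then have "j \<le> x" unfolding j_def by (rule Least_le)
      with that show False by simp
    qed
    have jn: "1 \<le> j" "j \<le> n" using j An by auto
    have "\<exists>i. i \<in> B \<and> i \<notin> A \<and> 1 \<le> i \<and> i < j"
    proof (rule ccontr)
      assume no: "\<not> ?thesis"
      have "{0<..j} - A \<subset> {0<..j} - B"
      proof
        show "{0<..j} - A \<subseteq> {0<..j} - B"
        proof
          fix x assume x: "x \<in> {0<..j} - A"
          with j have "x \<noteq> j" by blast
          with x have "1 \<le> x" "x < j" "x \<notin> A" by auto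
          with no x show "x \<in> {0<..j} - B" by blast
        qed
        have "j \<in> {0<..j} - B" "j \<notin> {0<..j} - A" using j jn by auto
        then show "{0<..j} - A \<noteq> {0<..j} - B" by metis
      qed
      then have "missed 0 j A < missed 0 j B"
        unfolding missed_def by (intro psubset_card_mono) auto
      with less.prems(3)[OF jn(2)] show False by simp
    qed
    then obtain i where i: "i \<in> B" "i \<notin> A" "1 \<le> i" "i < j" by blast
    define A' where "A' = (A - {j}) \<union> {i}"
    have A'G: "A' \<in> \<G>"
      using sh less.prems(1) i j jn unfolding shifted_def A'_def by blast
    have "A' - B = (A - B) - {j}" using i by (auto simp: A'_def)
    then have smaller: "card (A' - B) < card (A - B)"
      using j finA card_Diff1_less[of "A - B" j] by simp
    have "missed 0 k B \<le> missed 0 k A'" if k: "k \<le> n" for k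
    proof (cases "i \<le> k \<and> k < j")
      case True
      have "{0<..k} - B \<subseteq> ({0<..k} - A')" using jmin True i j by (auto simp: A'_def)
      then show ?thesis unfolding missed_def by (intro card_mono) auto
    next
      case False
      show ?thesis
      proof (cases "k < i")
        case True
        then have "{0<..k} - A' = {0<..k} - A" using i by (auto simp: A'_def)
        then show ?thesis using less.prems(3)[OF k] by (simp add: missed_def)
      next
        case nk: False
        with False have kj: "j \<le> k" by auto
        have eq: "{0<..k} - A' = insert j (({0<..k} - A) - {i})"
          using i j jn kj by (auto simp: A'_def)
        have mem: "i \<in> {0<..k} - A" "j \<notin> ({0<..k} - A) - {i}" using i j kj by auto
        have "card ({0<..k} - A') = card ({0<..k} - A)"
          unfolding eq using card_insert_disjoint[OF _ mem(2)] card_Suc_Diff1[OF _ mem(1)] by simp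
        then show ?thesis using less.prems(3)[OF k] by (simp add: missed_def)
      qed
    qed
    then show ?thesis using less.hyps[OF smaller A'G less.prems(2)] by blast
  qed
qed

text \<open>
  The points from \<open>t\<close> on are handed out greedily: when \<open>k\<close> is reached, only \<open>k - t\<close> points have been
  handed out, fewer than \<open>A\<close>, \<open>B\<close>, \<open>C\<close> together miss up to \<open>k\<close>, so one of the three still has a
  missing element to spare. It receives \<open>k\<close>, to which that missing element can be shifted.
\<close>

lemma cover_by_missed:
  fixes A B C :: "nat set"
  assumes t: "1 \<le> t"
    and big: "\<And>k. t \<le> k \<Longrightarrow> k \<le> n \<Longrightarrow> k < missed 0 k A + missed 0 k B + missed 0 k C + t"
    and d: "t + d \<le> Suc n"
  shows "\<exists>U V W. U \<union> V \<union> W = {t..<t + d} \<and> card U + card V + card W = d \<and>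
    (\<forall>k. card (U \<inter> {0<..k}) \<le> missed 0 k A \<and> card (V \<inter> {0<..k}) \<le> missed 0 k B
        \<and> card (W \<inter> {0<..k}) \<le> missed 0 k C)"
  using d
proof (induction d)
  case 0
  then show ?case by (intro exI[of _ "{}"]) auto
next
  case (Suc d)
  define k where "k = t + d"
  from Suc obtain U V W where IH: "U \<union> V \<union> W = {t..<k}" "card U + card V + card W = d"
    "\<And>j. card (U \<inter> {0<..j}) \<le> missed 0 j A" "\<And>j. card (V \<inter> {0<..j}) \<le> missed 0 j B"
    "\<And>j. card (W \<inter> {0<..j}) \<le> missed 0 j C"
    unfolding k_def by (auto dest!: Suc_leD)
  have fin: "finite U" "finite V" "finite W"
    using IH(1) by (metis finite_Un finite_atLeastLessThan)+
  have sub: "U \<subseteq> {t..<k}" "V \<subseteq> {t..<k}" "W \<subseteq> {t..<k}" using IH(1) by auto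
  have interval: "{t..<t + Suc d} = insert k {t..<k}" unfolding k_def by auto
  have union: "insert k U \<union> V \<union> W = {t..<t + Suc d}" "U \<union> insert k V \<union> W = {t..<t + Suc d}"
    "U \<union> V \<union> insert k W = {t..<t + Suc d}"
    unfolding interval IH(1)[symmetric] by auto
  have new: "k \<notin> U" "k \<notin> V" "k \<notin> W" using IH(1) by auto
  have ext: "card (insert k X \<inter> {0<..j}) \<le> missed 0 j Y"
    if X: "finite X" "X \<subseteq> {t..<k}" "card X < missed 0 k Y"
      and dom: "\<And>j. card (X \<inter> {0<..j}) \<le> missed 0 j Y" for X Y j
  proof (cases "k \<le> j")
    case True
    have "card (insert k X \<inter> {0<..j}) \<le> card (insert k X)" using X by (intro card_mono) auto
    also have "\<dots> \<le> Suc (card X)" by (simp add: card_insert_le_m1 X(1) card_insert_if)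
    also have "\<dots> \<le> missed 0 k Y" using X by simp
    also have "\<dots> \<le> missed 0 j Y" using True by (rule missed_mono)
    finally show ?thesis .
  next
    case False
    then have "insert k X \<inter> {0<..j} = X \<inter> {0<..j}" by auto
    then show ?thesis using dom by simp
  qed
  have "d < missed 0 k A + missed 0 k B + missed 0 k C"
    using big[of k] Suc.prems unfolding k_def by simp
  then consider "card U < missed 0 k A" | "card V < missed 0 k B" | "card W < missed 0 k C"
    using IH(2) by linarith
  then show ?case
  proof cases
    case 1
    show ?thesis
      using ext[of U A] sub IH(3-5) 1 fin new IH(2)
      by (intro exI[of _ "insert k U"] exI[of _ V] exI[of _ W] conjI allI union) simp_all
  next
    case 2
    show ?thesis
      using ext[of V B] sub IH(3-5) 2 fin new IH(2)
      by (intro exI[of _ U] exI[of _ "insert k V"] exI[of _ W] conjI allI union) simp_all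
  next
    case 3
    show ?thesis
      using ext[of W C] sub IH(3-5) 3 fin new IH(2)
      by (intro exI[of _ U] exI[of _ V] exI[of _ "insert k W"] conjI allI union) simp_all
  qed
qed

text \<open>
  Otherwise the missing elements of \<open>A\<close>, \<open>B\<close> and \<open>C\<close> are plentiful and early enough to be shifted
  so that they cover all of \<open>{t..n}\<close>; the shifted sets then meet only below \<open>t\<close>, in fewer than \<open>t\<close>
  points. This inequality is the form in which the intersection property enters the estimates.
\<close>

lemma three_missed_bound:
  assumes sh: "shifted n \<G>" and sub: "\<G> \<subseteq> Pow {1..n}" and int: "three_wise_intersecting t \<G>"
    and t: "1 \<le> t" "t \<le> n" and ABC: "A \<in> \<G>" "B \<in> \<G>" "C \<in> \<G>"
  shows "\<exists>k\<in>{t..n}. missed 0 k A + missed 0 k B + missed 0 k C + t \<le> k"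
proof (rule ccontr)
  assume "\<not> ?thesis"
  then have big: "k < missed 0 k A + missed 0 k B + missed 0 k C + t" if "t \<le> k" "k \<le> n" for k
    using that by (force simp: not_le)
  from cover_by_missed[of t n A B C "Suc n - t", OF t(1) big]
  obtain U V W where cov: "U \<union> V \<union> W = {t..<Suc n}"
    and dom: "\<And>k. card (U \<inter> {0<..k}) \<le> missed 0 k A" "\<And>k. card (V \<inter> {0<..k}) \<le> missed 0 k B"
      "\<And>k. card (W \<inter> {0<..k}) \<le> missed 0 k C"
    using t by auto
  have pick: "\<exists>D\<in>\<G>. D \<subseteq> {1..n} - X" if "Y \<in> \<G>" "\<And>k. card (X \<inter> {0<..k}) \<le> missed 0 k Y" for X Y
  proof (rule shifted_dominance[OF sh sub that(1)])
    fix k assume "k \<le> n"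
    then have "{0<..k} - ({1..n} - X) = X \<inter> {0<..k}" by auto
    then show "missed 0 k ({1..n} - X) \<le> missed 0 k Y" using that(2) by (simp add: missed_def)
  qed auto
  obtain A' B' C' where D: "A' \<in> \<G>" "B' \<in> \<G>" "C' \<in> \<G>"
      "A' \<subseteq> {1..n} - U" "B' \<subseteq> {1..n} - V" "C' \<subseteq> {1..n} - W"
    using pick[OF ABC(1) dom(1)] pick[OF ABC(2) dom(2)] pick[OF ABC(3) dom(3)] by blast
  have "A' \<inter> B' \<inter> C' \<subseteq> {1..<t}"
  proof
    fix x assume x: "x \<in> A' \<inter> B' \<inter> C'"
    then have "x \<notin> U \<union> V \<union> W" "x \<in> {1..n}" using D(4-6) by auto
    then show "x \<in> {1..<t}" unfolding cov by auto
  qed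
  then have "card (A' \<inter> B' \<inter> C') \<le> card {1..<t}" by (intro card_mono) auto
  also have "\<dots> < t" using t by simp
  finally show False using int D(1-3) unfolding three_wise_intersecting_def by force
qed

section \<open>Independent random subsets\<close>

text \<open>
  The weights are written as a product over the ground set, so that enlarging the ground set by one
  point multiplies them by \<open>p\<close> or \<open>1 - p\<close>. The ground set is kept variable because the estimates
  proceed block by block.
\<close>

definition prob :: "real \<Rightarrow> nat set \<Rightarrow> (nat set \<Rightarrow> bool) \<Rightarrow> real" where
  "prob p S P = (\<Sum>A\<in>{A\<in>Pow S. P A}. \<Prod>i\<in>S. if i \<in> A then p else 1 - p)"

lemma prob_cong:
  assumes "\<And>A. A \<subseteq> S \<Longrightarrow> P A \<longleftrightarrow> Q A"
  shows "prob p S P = prob p S Q"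
proof -
  have "{A\<in>Pow S. P A} = {A\<in>Pow S. Q A}" using assms by auto
  then show ?thesis by (simp add: prob_def)
qed

lemma prob_empty: "prob p {} P = (if P {} then 1 else 0)"
proof -
  have "{A\<in>Pow {}. P A} = (if P {} then {{}} else {})" by auto
  then show ?thesis unfolding prob_def by simp
qed

lemma prob_insert:
  assumes "finite S" "x \<notin> S"
  shows "prob p (insert x S) P = p * prob p S (\<lambda>A. P (insert x A)) + (1 - p) * prob p S P"
proof -
  let ?w = "\<lambda>S A. \<Prod>i\<in>S. if i \<in> A then p else 1 - p"
  let ?I = "{A\<in>Pow S. P (insert x A)}" and ?O = "{A\<in>Pow S. P A}"
  have split: "{A\<in>Pow (insert x S). P A} = insert x ` ?I \<union> ?O"
    by (auto simp: Pow_insert)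
  have inj: "inj_on (insert x) ?I" using assms(2) by (auto simp: inj_on_def)
  have w1: "?w (insert x S) (insert x A) = p * ?w S A" for A
  proof -
    have "?w S (insert x A) = ?w S A" by (intro prod.cong) (use assms in auto)
    then show ?thesis using assms by simp
  qed
  have w2: "?w (insert x S) A = (1 - p) * ?w S A" if "A \<in> ?O" for A
    using assms that by auto
  have "prob p (insert x S) P = (\<Sum>A\<in>insert x ` ?I. ?w (insert x S) A) + (\<Sum>A\<in>?O. ?w (insert x S) A)"
    unfolding prob_def split using assms by (intro sum.union_disjoint) auto
  also have "(\<Sum>A\<in>insert x ` ?I. ?w (insert x S) A) = (\<Sum>A\<in>?I. p * ?w S A)"
    by (subst sum.reindex[OF inj]) (simp only: o_def w1)
  also have "(\<Sum>A\<in>?O. ?w (insert x S) A) = (\<Sum>A\<in>?O. (1 - p) * ?w S A)"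
    by (intro sum.cong refl w2)
  finally show ?thesis by (simp only: prob_def sum_distrib_left)
qed

lemma prob_True: "finite S \<Longrightarrow> prob p S (\<lambda>_. True) = 1"
  by (induction S rule: finite_induct) (auto simp: prob_empty prob_insert)

lemma prob_False: "prob p S (\<lambda>_. False) = 0"
  by (simp add: prob_def)

lemma prob_mono:
  assumes "0 \<le> p" "p \<le> 1" "finite S" "\<And>A. A \<subseteq> S \<Longrightarrow> P A \<Longrightarrow> Q A"
  shows "prob p S P \<le> prob p S Q"
  unfolding prob_def by (intro sum_mono2 prod_nonneg) (use assms in auto)

lemma prob_le_1: "0 \<le> p \<Longrightarrow> p \<le> 1 \<Longrightarrow> finite S \<Longrightarrow> prob p S P \<le> 1"
  using prob_mono[of p S P "\<lambda>_. True"] by (simp add: prob_True)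

lemma prob_disj_le:
  assumes "0 \<le> p" "p \<le> 1" "finite S"
  shows "prob p S (\<lambda>A. P A \<or> Q A) \<le> prob p S P + prob p S Q"
proof -
  let ?w = "\<lambda>A. \<Prod>i\<in>S. if i \<in> A then p else 1 - p"
  have "{A\<in>Pow S. P A \<or> Q A} = {A\<in>Pow S. P A} \<union> {A\<in>Pow S. Q A}" by auto
  moreover have "sum ?w ({A\<in>Pow S. P A} \<inter> {A\<in>Pow S. Q A}) \<ge> 0"
    using assms by (intro sum_nonneg prod_nonneg) auto
  ultimately show ?thesis
    unfolding prob_def using assms(3)
      sum_Un[of "{A\<in>Pow S. P A}" "{A\<in>Pow S. Q A}" ?w] by force
qed

lemma prob_disj_disjoint:
  assumes "finite S" "\<And>A. \<not> (P A \<and> Q A)"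
  shows "prob p S (\<lambda>A. P A \<or> Q A) = prob p S P + prob p S Q"
proof -
  have "{A\<in>Pow S. P A \<or> Q A} = {A\<in>Pow S. P A} \<union> {A\<in>Pow S. Q A}" by auto
  then show ?thesis
    unfolding prob_def by simp (intro sum.union_disjoint, use assms in auto)
qed

lemma prob_indep:
  assumes "finite S" "finite T" "S \<inter> T = {}"
  shows "prob p (S \<union> T) (\<lambda>A. P (A \<inter> S) \<and> Q (A \<inter> T)) = prob p S P * prob p T Q"
  using assms
proof (induction S arbitrary: P rule: finite_induct)
  case empty
  have "prob p T (\<lambda>A. P (A \<inter> {}) \<and> Q (A \<inter> T)) = prob p T (\<lambda>A. P {} \<and> Q A)"
    by (intro prob_cong) (simp add: Int_absorb2)
  then show ?case by (simp add: prob_empty prob_False)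
next
  case (insert x S)
  have x: "x \<notin> S \<union> T" and dj: "S \<inter> T = {}" using insert by auto
  have 1: "prob p (S \<union> T) (\<lambda>A. P (insert x A \<inter> insert x S) \<and> Q (insert x A \<inter> T))
      = prob p S (\<lambda>A. P (insert x A)) * prob p T Q"
  proof -
    have "prob p (S \<union> T) (\<lambda>A. P (insert x A \<inter> insert x S) \<and> Q (insert x A \<inter> T))
        = prob p (S \<union> T) (\<lambda>A. P (insert x (A \<inter> S)) \<and> Q (A \<inter> T))"
    proof (intro prob_cong)
      fix A assume "A \<subseteq> S \<union> T"
      with x have "insert x A \<inter> insert x S = insert x (A \<inter> S)" "insert x A \<inter> T = A \<inter> T" by auto
      then show "P (insert x A \<inter> insert x S) \<and> Q (insert x A \<inter> T)
          \<longleftrightarrow> P (insert x (A \<inter> S)) \<and> Q (A \<inter> T)" by simp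
    qed
    with insert.IH[OF insert.prems(1) dj, of "\<lambda>A. P (insert x A)"] show ?thesis by simp
  qed
  have "prob p (S \<union> T) (\<lambda>A. P (A \<inter> insert x S) \<and> Q (A \<inter> T))
      = prob p (S \<union> T) (\<lambda>A. P (A \<inter> S) \<and> Q (A \<inter> T))"
  proof (intro prob_cong)
    fix A assume "A \<subseteq> S \<union> T"
    with x have "A \<inter> insert x S = A \<inter> S" by auto
    then show "P (A \<inter> insert x S) \<and> Q (A \<inter> T) \<longleftrightarrow> P (A \<inter> S) \<and> Q (A \<inter> T)" by simp
  qed
  then have 2: "prob p (S \<union> T) (\<lambda>A. P (A \<inter> insert x S) \<and> Q (A \<inter> T)) = prob p S P * prob p T Q"
    using insert.IH[OF insert.prems(1) dj] by simp
  have "prob p (insert x S \<union> T) (\<lambda>A. P (A \<inter> insert x S) \<and> Q (A \<inter> T))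
     = p * prob p (S \<union> T) (\<lambda>A. P (insert x A \<inter> insert x S) \<and> Q (insert x A \<inter> T))
      + (1 - p) * prob p (S \<union> T) (\<lambda>A. P (A \<inter> insert x S) \<and> Q (A \<inter> T))"
    using insert.hyps insert.prems x by (simp add: prob_insert)
  also have "\<dots> = prob p (insert x S) P * prob p T Q"
    unfolding 1 2 using insert.hyps by (simp add: prob_insert algebra_simps)
  finally show ?case .
qed

lemma prob_card_Diff_eq:
  assumes "finite S"
  shows "prob p S (\<lambda>A. card (S - A) = j) = real (card S choose j) * (1 - p) ^ j * p ^ (card S - j)"
  using assms
proof (induction S arbitrary: j rule: finite_induct)
  case empty
  then show ?case by (cases j) (auto simp: prob_empty)
next
  case (insert x S)
  have in_: "prob p S (\<lambda>A. card (insert x S - insert x A) = j) = prob p S (\<lambda>A. card (S - A) = j)"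
    using insert.hyps by (intro prob_cong arg_cong[where f = "\<lambda>X. card X = j"]) auto
  have out: "prob p S (\<lambda>A. card (insert x S - A) = j) = prob p S (\<lambda>A. Suc (card (S - A)) = j)"
  proof (intro prob_cong)
    fix A assume "A \<subseteq> S"
    then have "insert x S - A = insert x (S - A)" using insert.hyps by auto
    then show "card (insert x S - A) = j \<longleftrightarrow> Suc (card (S - A)) = j" using insert.hyps by simp
  qed
  show ?case
  proof (cases j)
    case 0
    then show ?thesis
      using insert by (simp add: prob_insert in_[unfolded 0] out[unfolded 0] prob_False del: card_0_eq)
  next
    case (Suc i)
    consider "card S < i" | "card S = i" | "i < card S" by linarith
    then show ?thesis
    proof cases
      case 3
      then have "card S - i = Suc (card S - Suc i)" by simp
      with insert Suc show ?thesis
        by (simp add: prob_insert in_[unfolded Suc] out[unfolded Suc] algebra_simps)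
    qed (use insert Suc in \<open>simp_all add: binomial_eq_0 prob_insert in_[unfolded Suc] out[unfolded Suc]\<close>)
  qed
qed

section \<open>Hitting probabilities of lines\<close>

text \<open>
  Read \<open>A\<close> as a walk that starts at height \<open>0\<close> at time \<open>a\<close>, climbs by \<open>1\<close> at each element of \<open>A\<close>
  and drops by \<open>r - 1\<close> at each missing one. At time \<open>k\<close> its height is \<open>k - a - r * missed a k A\<close>, and
  \<open>hits\<close> says that a height of at least \<open>u\<close> is attained by time \<open>n\<close>. The additive form avoids subtraction on
  natural numbers.
\<close>

definition hits :: "nat \<Rightarrow> nat \<Rightarrow> nat \<Rightarrow> nat \<Rightarrow> nat set \<Rightarrow> bool" where
  "hits r a n u A \<longleftrightarrow> (\<exists>k\<in>{a..n}. u + r * missed a k A + a \<le> k)"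

definition hits_twice :: "nat \<Rightarrow> nat \<Rightarrow> nat \<Rightarrow> nat \<Rightarrow> nat set \<Rightarrow> bool" where
  "hits_twice r a n u A \<longleftrightarrow>
    (\<exists>k\<in>{a..n}. \<exists>l\<in>{a..n}. k < l \<and> u + r * missed a k A + a \<le> k \<and> u + r * missed a l A + a \<le> l)"

lemma prob_first_step:
  assumes "a < n"
  shows "prob p {a<..n} P
    = p * prob p {Suc a<..n} (\<lambda>A. P (insert (Suc a) A)) + (1 - p) * prob p {Suc a<..n} P"
proof -
  have "{a<..n} = insert (Suc a) {Suc a<..n}" using assms by auto
  then show ?thesis by (simp add: prob_insert)
qed

lemma missed_first_in: "a < k \<Longrightarrow> missed a k (insert (Suc a) A) = missed (Suc a) k A"
  using missed_split[of a "Suc a" k] by (simp add: missed_single missed_insert)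

lemma missed_first_out: "a < k \<Longrightarrow> Suc a \<notin> A \<Longrightarrow> missed a k A = Suc (missed (Suc a) k A)"
  using missed_split[of a "Suc a" k] by (simp add: missed_single)

text \<open>
  The hypothesis on \<open>b\<close> makes \<open>b\<close> to the power of the remaining height a supermartingale. As an
  induction on the length of the walk, it is a case distinction on the first step.
\<close>

lemma prob_hits_le:
  assumes p: "0 \<le> p" "p \<le> 1" and b: "0 \<le> b" "p + (1 - p) * b ^ r \<le> b"
  shows "prob p {a<..n} (hits r a n u) \<le> b ^ u"
proof (induction "n - a" arbitrary: a u)
  case 0
  then have an: "{a<..n} = {}" by auto
  show ?case
  proof (cases u)
    case 0
    then show ?thesis using prob_le_1[OF p] by simp
  next
    case (Suc v)
    then have "\<not> hits r a n u {}" using 0 by (auto simp: hits_def)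
    then show ?thesis using b by (simp add: an prob_empty)
  qed
next
  case (Suc d)
  then have an: "a < n" by simp
  show ?case
  proof (cases u)
    case 0
    then show ?thesis using prob_le_1[OF p] by simp
  next
    case (Suc v)
    have gt: "a < k" if "Suc v + x + a \<le> k" for k x using that by simp
    have 1: "prob p {Suc a<..n} (\<lambda>A. hits r a n u (insert (Suc a) A)) \<le> b ^ v"
    proof (rule order_trans[OF prob_mono[OF p] Suc.hyps(1)])
      fix A assume "hits r a n u (insert (Suc a) A)"
      then obtain k where k: "k \<in> {a..n}" "Suc v + r * missed a k (insert (Suc a) A) + a \<le> k"
        unfolding hits_def Suc by blast
      with gt[OF k(2)] show "hits r (Suc a) n v A"
        unfolding hits_def
        by (intro bexI[of _ k]) (simp_all add: missed_first_in[OF gt[OF k(2)]])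
    qed (use Suc.hyps in auto)
    have 2: "prob p {Suc a<..n} (hits r a n u) \<le> b ^ (v + r)"
    proof (rule order_trans[OF prob_mono[OF p] Suc.hyps(1)])
      fix A assume A: "A \<subseteq> {Suc a<..n}" and "hits r a n u A"
      then obtain k where k: "k \<in> {a..n}" "Suc v + r * missed a k A + a \<le> k"
        unfolding hits_def Suc by blast
      have "missed a k A = Suc (missed (Suc a) k A)"
        using A by (intro missed_first_out gt[OF k(2)]) auto
      with k gt[OF k(2)] show "hits r (Suc a) n (v + r) A"
        unfolding hits_def by (intro bexI[of _ k]) simp_all
    qed (use Suc.hyps in auto)
    have "prob p {a<..n} (hits r a n u) \<le> p * b ^ v + (1 - p) * b ^ (v + r)"
      unfolding prob_first_step[OF an] using p by (intro add_mono mult_left_mono 1 2) auto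
    also have "\<dots> = b ^ v * (p + (1 - p) * b ^ r)" by (simp add: power_add algebra_simps)
    also have "\<dots> \<le> b ^ v * b" using b by (intro mult_left_mono) auto
    finally show ?thesis by (simp add: Suc mult_ac)
  qed
qed

text \<open>
  Conditioning on the first step reduces the claim to \<open>u = 0\<close>, where the start is the first
  visit. A second visit then occurs at once if the first step goes up; if it drops by \<open>r\<close>, the walk
  has to climb back by \<open>r\<close>. Since walks climb only by single steps, a walk that ever exceeds height
  \<open>u\<close> is at height \<open>u\<close> just before, so the event also contains those walks.
\<close>

lemma prob_hits_twice_le:
  assumes p: "0 \<le> p" "p \<le> 1" and b: "0 \<le> b" "p + (1 - p) * b ^ Suc r \<le> b"
  shows "prob p {a<..n} (hits_twice (Suc r) a n u) \<le> b ^ u * (p + (1 - p) * b ^ r)"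
proof (induction "n - a" arbitrary: a u)
  case 0
  then have "\<not> hits_twice (Suc r) a n u A" for A by (auto simp: hits_twice_def)
  then have "prob p {a<..n} (hits_twice (Suc r) a n u) = 0" by (simp add: prob_def)
  then show ?case using b p by simp
next
  case (Suc d)
  then have an: "a < n" by simp
  show ?case
  proof (cases u)
    case 0
    have 1: "prob p {Suc a<..n} (\<lambda>A. hits_twice (Suc r) a n u (insert (Suc a) A)) \<le> 1"
      by (simp add: prob_le_1 p)
    have 2: "prob p {Suc a<..n} (hits_twice (Suc r) a n u) \<le> b ^ r"
    proof (rule order_trans[OF prob_mono[OF p] prob_hits_le[OF p b]])
      fix A assume A: "A \<subseteq> {Suc a<..n}" and "hits_twice (Suc r) a n u A"
      then obtain k l where k: "k \<in> {a..n}" "l \<in> {a..n}" "k < l" "0 + Suc r * missed a l A + a \<le> l"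
        unfolding hits_twice_def 0 by blast
      have "missed a l A = Suc (missed (Suc a) l A)"
        using A k by (intro missed_first_out) auto
      with k show "hits (Suc r) (Suc a) n r A"
        unfolding hits_def by (intro bexI[of _ l]) simp_all
    qed auto
    show ?thesis
      unfolding prob_first_step[OF an] using add_mono[OF mult_left_mono[OF 1] mult_left_mono[OF 2]] p 0
      by simp
  next
    case (Suc v)
    have gt: "a < k" if "Suc v + x + a \<le> k" for k x using that by simp
    let ?w = "p + (1 - p) * b ^ r"
    have w: "0 \<le> ?w" using p b by simp
    have 1: "prob p {Suc a<..n} (\<lambda>A. hits_twice (Suc r) a n u (insert (Suc a) A)) \<le> b ^ v * ?w"
    proof (rule order_trans[OF prob_mono[OF p] Suc.hyps(1)])
      fix A assume "hits_twice (Suc r) a n u (insert (Suc a) A)"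
      then obtain k l where k: "k \<in> {a..n}" "l \<in> {a..n}" "k < l"
        "Suc v + Suc r * missed a k (insert (Suc a) A) + a \<le> k"
        "Suc v + Suc r * missed a l (insert (Suc a) A) + a \<le> l"
        unfolding hits_twice_def Suc by blast
      with gt[OF k(4)] gt[OF k(5)] show "hits_twice (Suc r) (Suc a) n v A"
        unfolding hits_twice_def
        by (intro bexI[of _ k] bexI[of _ l])
           (simp_all add: missed_first_in[OF gt[OF k(4)]] missed_first_in[OF gt[OF k(5)]])
    qed (use Suc.hyps in auto)
    have 2: "prob p {Suc a<..n} (hits_twice (Suc r) a n u) \<le> b ^ (v + Suc r) * ?w"
    proof (rule order_trans[OF prob_mono[OF p] Suc.hyps(1)])
      fix A assume A: "A \<subseteq> {Suc a<..n}" and "hits_twice (Suc r) a n u A"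
      then obtain k l where k: "k \<in> {a..n}" "l \<in> {a..n}" "k < l"
        "Suc v + Suc r * missed a k A + a \<le> k" "Suc v + Suc r * missed a l A + a \<le> l"
        unfolding hits_twice_def Suc by blast
      have "missed a k A = Suc (missed (Suc a) k A)" "missed a l A = Suc (missed (Suc a) l A)"
        using A by (intro missed_first_out gt[OF k(4)] gt[OF k(5)]; auto)+
      with k gt[OF k(4)] gt[OF k(5)] show "hits_twice (Suc r) (Suc a) n (v + Suc r) A"
        unfolding hits_twice_def by (intro bexI[of _ k] bexI[of _ l]) simp_all
    qed (use Suc.hyps in auto)
    have "prob p {a<..n} (hits_twice (Suc r) a n u) \<le> p * (b ^ v * ?w) + (1 - p) * (b ^ (v + Suc r) * ?w)"
      unfolding prob_first_step[OF an] using p by (intro add_mono mult_left_mono 1 2) auto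
    also have "\<dots> = b ^ v * ?w * (p + (1 - p) * b ^ Suc r)" by (simp add: power_add algebra_simps)
    also have "\<dots> \<le> b ^ v * ?w * b" using b w by (intro mult_left_mono mult_nonneg_nonneg) auto
    finally show ?thesis by (simp add: Suc mult_ac)
  qed
qed

section \<open>Measures of the Frankl families\<close>

lemma prob_interval_indep:
  assumes "a \<le> b" "b \<le> c"
    and "\<And>A. P (A \<inter> {a<..b}) \<longleftrightarrow> P A" "\<And>A. Q (A \<inter> {b<..c}) \<longleftrightarrow> Q A"
  shows "prob p {a<..c} (\<lambda>A. P A \<and> Q A) = prob p {a<..b} P * prob p {b<..c} Q"
proof -
  have "{a<..c} = {a<..b} \<union> {b<..c}" using assms(1,2) by auto
  moreover have "prob p ({a<..b} \<union> {b<..c}) (\<lambda>A. P (A \<inter> {a<..b}) \<and> Q (A \<inter> {b<..c}))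
      = prob p {a<..b} P * prob p {b<..c} Q"
    by (rule prob_indep) auto
  ultimately show ?thesis by (simp only: assms(3,4))
qed

lemma missed_Int_interval [simp]:
  "a \<le> b \<Longrightarrow> c \<le> d \<Longrightarrow> missed b c (A \<inter> {a<..d}) = missed b c A"
  by (rule missed_Int) auto

lemma hits_Int_interval [simp]: "a \<le> b \<Longrightarrow> hits r b n u (A \<inter> {a<..n}) \<longleftrightarrow> hits r b n u A"
  unfolding hits_def by (intro bex_cong refl) simp

lemma prob_missed_eq:
  "prob p {a<..b} (\<lambda>A. missed a b A = j) = real (b - a choose j) * (1 - p) ^ j * p ^ (b - a - j)"
  unfolding missed_def using prob_card_Diff_eq[of "{a<..b}" p j] by simp

lemma prob_missed_le_Suc:
  "prob p {a<..b} (\<lambda>A. missed a b A \<le> Suc j)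
    = prob p {a<..b} (\<lambda>A. missed a b A \<le> j) + prob p {a<..b} (\<lambda>A. missed a b A = Suc j)"
  by (subst prob_disj_disjoint[symmetric]) (auto simp: le_Suc_eq)

lemma prob_prefix:
  assumes "b \<le> c"
  shows "prob p {a<..c} (\<lambda>A. missed a b A \<le> j) = prob p {a<..b} (\<lambda>A. missed a b A \<le> j)"
proof (cases "a \<le> b")
  case True
  then show ?thesis
    using prob_interval_indep[of a b c "\<lambda>A. missed a b A \<le> j" "\<lambda>_. True" p] assms
    by (simp add: prob_True)
next
  case False
  then have "missed a b A = 0" for A by (simp add: missed_def)
  then show ?thesis by (simp add: prob_True)
qed

abbreviation frankl_measure :: "real \<Rightarrow> nat \<Rightarrow> nat \<Rightarrow> real" where
  "frankl_measure p t s \<equiv> prob p {0<..t + 3 * s} (\<lambda>A. missed 0 (t + 3 * s) A \<le> s)"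

text \<open>
  Passing from \<open>N\<close> to \<open>N + 3\<close>, a set with exactly \<open>s\<close> missing elements may afford one more, and a set
  with \<open>Suc s\<close> none. Applied with \<open>N = t + 3 * s\<close>, this compares consecutive Frankl families.
\<close>

lemma prob_missed_three_steps:
  assumes p: "0 \<le> p" "p \<le> 1"
  shows "prob p {0<..N + 3} (\<lambda>A. missed 0 (N + 3) A \<le> Suc s)
    \<le> prob p {0<..N} (\<lambda>A. missed 0 N A < s)
      + prob p {0<..N} (\<lambda>A. missed 0 N A = s) * (p ^ 3 + 3 * p\<^sup>2 * (1 - p))
      + prob p {0<..N} (\<lambda>A. missed 0 N A = Suc s) * p ^ 3"
proof -
  let ?W = "{0<..N + 3}"
  have split: "missed 0 (N + 3) A = missed 0 N A + missed N (N + 3) A" for A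
    by (rule missed_split) auto
  have le0: "missed N (N + 3) A \<le> 0 \<longleftrightarrow> missed N (N + 3) A = 0" for A by simp
  have z: "prob p {N<..N + 3} (\<lambda>A. missed N (N + 3) A = 0) = p ^ 3"
    by (simp add: prob_missed_eq)
  have o: "prob p {N<..N + 3} (\<lambda>A. missed N (N + 3) A \<le> Suc 0) = p ^ 3 + 3 * p\<^sup>2 * (1 - p)"
    unfolding prob_missed_le_Suc le0 z by (simp add: prob_missed_eq numeral_eq_Suc)
  have "prob p ?W (\<lambda>A. missed 0 (N + 3) A \<le> Suc s)
    \<le> prob p ?W (\<lambda>A. (missed 0 N A < s \<and> True) \<or> (missed 0 N A = s \<and> missed N (N + 3) A \<le> Suc 0)
        \<or> (missed 0 N A = Suc s \<and> missed N (N + 3) A = 0))"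
    by (rule prob_mono[OF p]) (auto simp: split)
  also have "\<dots> \<le> prob p ?W (\<lambda>A. missed 0 N A < s \<and> True)
      + (prob p ?W (\<lambda>A. missed 0 N A = s \<and> missed N (N + 3) A \<le> Suc 0)
        + prob p ?W (\<lambda>A. missed 0 N A = Suc s \<and> missed N (N + 3) A = 0))"
    by (intro order_trans[OF prob_disj_le[OF p]] add_left_mono prob_disj_le[OF p]) auto
  also have "prob p ?W (\<lambda>A. missed 0 N A < s \<and> True) = prob p {0<..N} (\<lambda>A. missed 0 N A < s)"
    by (subst prob_interval_indep[of 0 N]) (auto simp: prob_True)
  also have "prob p ?W (\<lambda>A. missed 0 N A = s \<and> missed N (N + 3) A \<le> Suc 0)
      = prob p {0<..N} (\<lambda>A. missed 0 N A = s) * (p ^ 3 + 3 * p\<^sup>2 * (1 - p))"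
    by (subst prob_interval_indep[of 0 N]) (auto simp: o[simplified])
  also have "prob p ?W (\<lambda>A. missed 0 N A = Suc s \<and> missed N (N + 3) A = 0)
      = prob p {0<..N} (\<lambda>A. missed 0 N A = Suc s) * p ^ 3"
    by (subst prob_interval_indep[of 0 N]) (auto simp: z)
  finally show ?thesis by (simp add: add.assoc)
qed

lemma frankl_measure_0: "frankl_measure p t 0 = p ^ t"
  by (simp add: prob_missed_eq)

text \<open>
  The sets gained by the next Frankl family are no heavier than those lost: the factor
  \<open>(1 - p)\<^sup>2 * (1 + 2 * p) = 1 - p ^ 3 - 3 * p\<^sup>2 * (1 - p)\<close> is the probability of missing at least two of
  three points. For \<open>s = 0\<close> the inequality is the hypothesis on \<open>t\<close> itself; for larger \<open>s\<close> the
  binomial ratio \<open>(t + 2 * s) / Suc s\<close> grows slowly enough.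
\<close>

lemma point_mass_ratio:
  fixes p :: real
  assumes p: "0 \<le> p" "p \<le> 1/2" and t: "real t * p\<^sup>2 \<le> (1 - p) * (1 + 2 * p)"
  shows "prob p {0<..t + 3 * s} (\<lambda>A. missed 0 (t + 3 * s) A = Suc s) * p ^ 3
    \<le> prob p {0<..t + 3 * s} (\<lambda>A. missed 0 (t + 3 * s) A = s) * ((1 - p)\<^sup>2 * (1 + 2 * p))"
proof (cases "t + 2 * s = 0")
  case True
  then show ?thesis using p by (simp add: prob_empty)
next
  case False
  let ?N = "t + 3 * s" and ?q = "1 - p"
  define c where "c = real (?N choose s) * ?q ^ s * p ^ (t + 2 * s)"
  have c: "0 \<le> c" unfolding c_def using p by simp
  have N: "?N - s = t + 2 * s" by simp
  have "Suc s * (?N choose Suc s) = (?N choose s) * (?N - s)"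
    by (metis binomial_absorb_comp binomial_absorption mult.commute)
  then have ch: "real (Suc s) * real (?N choose Suc s) = real (?N choose s) * real (t + 2 * s)"
    unfolding N of_nat_mult[symmetric] by simp
  have pw: "p ^ (t + 2 * s) * p\<^sup>2 = p ^ (?N - Suc s) * p ^ 3"
    unfolding power_add[symmetric] using False by (intro arg_cong[where f = "\<lambda>i. p ^ i"]) arith
  have "real (Suc s) * (real (?N choose Suc s) * ?q ^ Suc s * p ^ (?N - Suc s) * p ^ 3)
      = (real (Suc s) * real (?N choose Suc s)) * ?q ^ Suc s * (p ^ (?N - Suc s) * p ^ 3)"
    by (simp only: mult_ac)
  also have "\<dots> = c * ?q * (real (t + 2 * s) * p\<^sup>2)"
    unfolding ch pw[symmetric] c_def by (simp only: power_Suc mult_ac)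
  also have "\<dots> \<le> c * ?q * (real (Suc s) * (?q * (1 + 2 * p)))"
  proof (rule mult_left_mono)
    have "2 * p\<^sup>2 \<le> ?q * (1 + 2 * p)"
    proof -
      have "p * p \<le> 1/2 * p" using p by (intro mult_right_mono) auto
      then show ?thesis using p by (simp add: power2_eq_square algebra_simps)
    qed
    then have "real s * (2 * p\<^sup>2) \<le> real s * (?q * (1 + 2 * p))" by (rule mult_left_mono) simp
    then show "real (t + 2 * s) * p\<^sup>2 \<le> real (Suc s) * (?q * (1 + 2 * p))"
      using t by (simp add: algebra_simps)
    show "0 \<le> c * ?q" using c p by simp
  qed
  also have "\<dots> = real (Suc s) * (c * (?q\<^sup>2 * (1 + 2 * p)))" by (simp only: power2_eq_square mult_ac)
  finally have "real (?N choose Suc s) * ?q ^ Suc s * p ^ (?N - Suc s) * p ^ 3 \<le> c * (?q\<^sup>2 * (1 + 2 * p))"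
    by (rule mult_left_le_imp_le) simp
  then show ?thesis by (simp only: prob_missed_eq c_def N diff_zero)
qed

lemma frankl_measure_Suc_le:
  fixes p :: real
  assumes p: "0 \<le> p" "p \<le> 1/2" and t: "real t * p\<^sup>2 \<le> (1 - p) * (1 + 2 * p)"
  shows "frankl_measure p t (Suc s) \<le> frankl_measure p t s"
proof -
  let ?N = "t + 3 * s"
  define x where "x = prob p {0<..?N} (\<lambda>A. missed 0 ?N A = s)"
  have N: "t + 3 * Suc s = ?N + 3" by simp
  have "frankl_measure p t (Suc s) \<le> prob p {0<..?N} (\<lambda>A. missed 0 ?N A < s)
      + x * (p ^ 3 + 3 * p\<^sup>2 * (1 - p)) + prob p {0<..?N} (\<lambda>A. missed 0 ?N A = Suc s) * p ^ 3"
    unfolding N x_def using p by (intro prob_missed_three_steps) auto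
  also have "\<dots> \<le> prob p {0<..?N} (\<lambda>A. missed 0 ?N A < s)
      + x * (p ^ 3 + 3 * p\<^sup>2 * (1 - p)) + x * ((1 - p)\<^sup>2 * (1 + 2 * p))"
    unfolding x_def by (intro add_left_mono point_mass_ratio assms)
  also have "\<dots> = prob p {0<..?N} (\<lambda>A. missed 0 ?N A < s) + x"
    by (simp add: power2_eq_square power3_eq_cube algebra_simps)
  also have "\<dots> = frankl_measure p t s"
    unfolding x_def by (subst prob_disj_disjoint[symmetric]) (auto simp: le_less)
  finally show ?thesis .
qed

lemma frankl_measure_antimono:
  fixes p :: real
  assumes "0 \<le> p" "p \<le> 1/2" "real t * p\<^sup>2 \<le> (1 - p) * (1 + 2 * p)" "r \<le> s"
  shows "frankl_measure p t s \<le> frankl_measure p t r"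
  using lift_Suc_antimono_le[of "frankl_measure p t"] frankl_measure_Suc_le assms by blast

text \<open>
  The main contribution comes from the sets that miss exactly two of the first \<open>t + 3\<close> points. Its
  ratio to \<open>p ^ t\<close> is about \<open>(t * p\<^sup>2)\<^sup>2 / 2\<close>, hence about \<open>1/2\<close> at most. The remaining sets add no more
  than \<open>3 * p\<^sup>2\<close>, which stays below \<open>24/100\<close> in the given range of \<open>p\<close>.
\<close>

lemma frankl_measure_2_le:
  fixes p :: real
  assumes p: "0 < p" "p \<le> 28/100" and t: "real t * p\<^sup>2 \<le> (1 - p) * (1 + 2 * p)"
  shows "frankl_measure p t 2 \<le> 74/100 * p ^ t"
proof -
  let ?q = "1 - p"
  define y where "y = real (t + 3) * p\<^sup>2"
  have y: "y \<le> 1 + p + p\<^sup>2" "y - p\<^sup>2 \<le> 1 + p" "0 \<le> y" "0 \<le> y - p\<^sup>2"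
    using t p unfolding y_def by (simp_all add: power2_eq_square algebra_simps)
  have q: "0 \<le> ?q" "?q \<le> 1" using p by auto
  have "frankl_measure p t 2 \<le> prob p {0<..t + 3} (\<lambda>A. missed 0 (t + 3) A < 1)
      + prob p {0<..t + 3} (\<lambda>A. missed 0 (t + 3) A = 1) * (p ^ 3 + 3 * p\<^sup>2 * ?q)
      + prob p {0<..t + 3} (\<lambda>A. missed 0 (t + 3) A = 2) * p ^ 3"
    using prob_missed_three_steps[of p "t + 3" 1] p by (simp add: numeral_2_eq_2 numeral_3_eq_3)
  also have "\<dots> = p ^ t * (p ^ 3 + y * ?q * (p ^ 3 + 3 * p\<^sup>2 * ?q) + y * (y - p\<^sup>2) / 2 * ?q\<^sup>2)"
  proof -
    have 0: "prob p {0<..t + 3} (\<lambda>A. missed 0 (t + 3) A < 1) = p ^ t * p ^ 3"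
      by (simp add: prob_missed_eq power_add)
    have 1: "prob p {0<..t + 3} (\<lambda>A. missed 0 (t + 3) A = 1) = p ^ t * (y * ?q)"
      by (simp add: prob_missed_eq power_add y_def power2_eq_square)
    have "real (t + 3 choose 2) = real (t + 3) * real (t + 2) / 2"
      by (simp add: choose_two real_of_nat_div algebra_simps)
    moreover have "y * (y - p\<^sup>2) = real (t + 3) * real (t + 2) * p ^ 4"
      by (simp add: y_def power2_eq_square power4_eq_xxxx algebra_simps)
    ultimately have 2: "prob p {0<..t + 3} (\<lambda>A. missed 0 (t + 3) A = 2) * p ^ 3
        = p ^ t * (y * (y - p\<^sup>2) / 2 * ?q\<^sup>2)"
      by (simp only: prob_missed_eq) (simp add: power_add power3_eq_cube power4_eq_xxxx)
    show ?thesis unfolding 0 1 2 by (simp add: algebra_simps)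
  qed
  also have "\<dots> \<le> p ^ t * (74/100)"
  proof (rule mult_left_mono)
    \<comment> \<open>Each of the two factors close to \<open>1 + p\<close> is paired with a factor \<open>?q\<close>, which compensates it.\<close>
    have yq: "y * ?q \<le> 1"
    proof -
      have "y * ?q \<le> (1 + p + p\<^sup>2) * ?q" using y q by (intro mult_right_mono) auto
      also have "\<dots> = 1 - p ^ 3" by (simp add: power2_eq_square power3_eq_cube algebra_simps)
      also have "\<dots> \<le> 1" using p by simp
      finally show ?thesis .
    qed
    have zq: "(y - p\<^sup>2) * ?q \<le> 1"
    proof -
      have "(y - p\<^sup>2) * ?q \<le> (1 + p) * ?q" using y q by (intro mult_right_mono) auto
      also have "\<dots> = 1 - p\<^sup>2" by (simp add: power2_eq_square algebra_simps)
      also have "\<dots> \<le> 1" by simp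
      finally show ?thesis .
    qed
    have m: "p ^ 3 + 3 * p\<^sup>2 * ?q = 3 * p\<^sup>2 - 2 * p ^ 3"
      by (simp add: power2_eq_square power3_eq_cube algebra_simps)
    have "p * p \<le> 28/100 * (28/100)" using p by (intro mult_mono) auto
    then have pp: "p\<^sup>2 \<le> 784/10000" by (simp add: power2_eq_square)
    have "y * ?q * (p ^ 3 + 3 * p\<^sup>2 * ?q) \<le> 1 * (p ^ 3 + 3 * p\<^sup>2 * ?q)"
      using yq p q by (intro mult_right_mono) auto
    then have one: "y * ?q * (p ^ 3 + 3 * p\<^sup>2 * ?q) \<le> 3 * p\<^sup>2 - 2 * p ^ 3" unfolding m by simp
    have "(y * ?q) * ((y - p\<^sup>2) * ?q) \<le> 1 * 1"
      using yq zq y q by (intro mult_mono) auto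
    then have "(y * ?q) * ((y - p\<^sup>2) * ?q) / 2 \<le> 1/2" by simp
    moreover have "y * (y - p\<^sup>2) / 2 * ?q\<^sup>2 = (y * ?q) * ((y - p\<^sup>2) * ?q) / 2"
      by (simp add: power2_eq_square)
    ultimately have two: "y * (y - p\<^sup>2) / 2 * ?q\<^sup>2 \<le> 1/2" by (rule ord_eq_le_trans[rotated])
    have "0 \<le> p ^ 3" using p by simp
    with pp have "p ^ 3 + (3 * p\<^sup>2 - 2 * p ^ 3) + 1/2 \<le> 74/100" by linarith
    with one two show "p ^ 3 + y * ?q * (p ^ 3 + 3 * p\<^sup>2 * ?q) + y * (y - p\<^sup>2) / 2 * ?q\<^sup>2 \<le> 74/100"
      by (meson add_mono order_refl order_trans)
  qed (use p in simp)
  finally show ?thesis by simp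
qed

section \<open>The hitting root and the threshold\<close>

lemma hitting_root_exists:
  fixes p :: real
  assumes "0 < p" "p \<le> 28/100"
  obtains b where "0 < b" "b \<le> 3/10" "(1 - p) * (1 + b + b\<^sup>2) = 1"
proof -
  define c where "c = p / (1 - p)"
  define s where "s = sqrt (1 + 4 * c)"
  define b where "b = (s - 1) / 2"
  have c: "0 < c" "c \<le> 39/100" "(1 - p) * c = p"
    using assms by (simp_all add: c_def divide_le_eq)
  have s: "s\<^sup>2 = 1 + 4 * c" "1 < s" unfolding s_def using c by simp_all
  have "s \<le> sqrt ((16/10)\<^sup>2)"
    unfolding s_def using c by (intro real_sqrt_le_mono) (simp add: power2_eq_square)
  then have "s \<le> 16/10" by simp
  with s have "0 < b" "b \<le> 3/10" by (auto simp: b_def)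
  moreover have "(1 - p) * (1 + b + b\<^sup>2) = 1"
  proof -
    have "b + b\<^sup>2 = (s\<^sup>2 - 1) / 4" by (simp add: b_def power2_eq_square field_simps)
    also have "\<dots> = c" using s(1) by simp
    finally have "1 + b + b\<^sup>2 = 1 + c" by simp
    then show ?thesis using c(3) by (simp add: algebra_simps)
  qed
  ultimately show thesis using that by blast
qed

text \<open>
  The equation \<open>p + (1 - p) * b ^ 3 = b\<close> has the trivial root \<open>1\<close>; dividing it out leaves the
  quadratic \<open>(1 - p) * (b + b\<^sup>2) = p\<close>, which is the hypothesis in a form that expresses \<open>1 - p\<close>
  through \<open>b\<close>.
\<close>

lemma hitting_root:
  fixes p b :: real
  assumes "(1 - p) * (1 + b + b\<^sup>2) = 1"
  shows "p = (1 - p) * (b * (1 + b))" "p + (1 - p) * b ^ 3 = b"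
proof -
  have "(1 - p) * (1 + b + b\<^sup>2) = (1 - p) + (1 - p) * (b * (1 + b))"
    by (simp add: power2_eq_square algebra_simps)
  with assms show 1: "p = (1 - p) * (b * (1 + b))" by linarith
  have "b * ((1 - p) * (1 + b + b\<^sup>2)) = (1 - p) * (b * (1 + b)) + (1 - p) * b ^ 3"
    by (simp add: power2_eq_square power3_eq_cube algebra_simps)
  with assms show "p + (1 - p) * b ^ 3 = b" by (simp add: 1[symmetric])
qed

text \<open>
  The ratio \<open>b / p\<close> is \<open>1 + x\<close> with \<open>x = (1 - p) * b ^ 3 / p\<close>, about \<open>p\<^sup>2\<close>, whereas \<open>t\<close> is about
  \<open>1 / p\<^sup>2\<close> at most, so \<open>(b / p) ^ t\<close> cannot exceed \<open>exp 1\<close>. Expressing \<open>p\<close> through \<open>b\<close> turns the claim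
  \<open>t * x \<le> 1\<close> into \<open>1 + 3 * b + 3 * b\<^sup>2 \<le> (1 + b) ^ 3\<close>.
\<close>

lemma hitting_root_power_le:
  fixes p b :: real
  assumes b: "0 < b" "(1 - p) * (1 + b + b\<^sup>2) = 1" and p: "0 < p" "p < 1"
    and t: "real t * p\<^sup>2 \<le> (1 - p) * (1 + 2 * p)"
  shows "b ^ t \<le> 272/100 * p ^ t"
proof -
  let ?q = "1 - p"
  define x where "x = (b - p) / p"
  have "x * p = b - p" using p by (simp add: x_def)
  then have x: "b = p * (1 + x)" "x * p = ?q * b ^ 3"
    using hitting_root(2)[OF b(2)] by (simp_all add: algebra_simps)
  have "0 \<le> ?q * b ^ 3" using p b by simp
  then have x0: "0 \<le> x" unfolding x(2)[symmetric] using p by (simp add: zero_le_mult_iff)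
  \<comment> \<open>Since the hypothesis on \<open>b\<close> reads \<open>1 = ?q * (1 + b + b\<^sup>2)\<close>, both sides become multiples of \<open>?q\<close>.\<close>
  have "1 + 2 * p = 3 * (?q * (1 + b + b\<^sup>2)) - 2 * ?q" unfolding b(2) by simp
  also have "\<dots> = ?q * (1 + b) ^ 3 - ?q * b ^ 3"
    by (simp add: power2_eq_square power3_eq_cube algebra_simps)
  finally have key: "1 + 2 * p \<le> ?q * (1 + b) ^ 3" using p b by simp
  have "(real t * x) * p ^ 3 = (real t * p\<^sup>2) * (x * p)"
    by (simp add: power2_eq_square power3_eq_cube)
  also have "\<dots> \<le> (?q * (1 + 2 * p)) * (?q * b ^ 3)"
    unfolding x(2) using t p b by (intro mult_right_mono) auto
  also have "\<dots> \<le> (?q * (?q * (1 + b) ^ 3)) * (?q * b ^ 3)"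
    using key p b by (intro mult_right_mono mult_left_mono) auto
  also have "\<dots> = (?q * (b * (1 + b))) ^ 3"
    by (simp add: power_mult_distrib power3_eq_cube)
  also have "\<dots> = 1 * p ^ 3" by (simp only: hitting_root(1)[OF b(2), symmetric] mult_1)
  finally have tx: "real t * x \<le> 1" by (rule mult_right_le_imp_le) (use p in simp)
  have "(1 + x) ^ t \<le> exp x ^ t" using x0 by (intro power_mono exp_ge_add_one_self) auto
  also have "\<dots> = exp (real t * x)" by (simp add: exp_of_nat_mult)
  also have "\<dots> \<le> exp 1" using tx by simp
  also have "\<dots> \<le> 272/100" using e_less_272 by simp
  finally have "p ^ t * (1 + x) ^ t \<le> p ^ t * (272/100)" using p by (intro mult_left_mono) auto
  moreover have "b ^ t = p ^ t * (1 + x) ^ t" by (subst x(1)) (rule power_mult_distrib)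
  ultimately show ?thesis by simp
qed

text \<open>
  The second inequality is the condition \<open>p \<le> p0 t\<close> solved for \<open>t\<close>: it says that the Frankl family
  with \<open>s = 1\<close> is at most as heavy as the one with \<open>s = 0\<close>. The first one uses \<open>t \<ge> 15\<close>.
\<close>

lemma p0_bounds:
  assumes t: "t \<ge> 15" and p: "0 < p" "p \<le> p0 t"
  shows "p \<le> 28/100" "real t * p\<^sup>2 \<le> (1 - p) * (1 + 2 * p)"
proof -
  define r where "r = sqrt (4 * real t + 9)"
  have r2: "r\<^sup>2 = 4 * real t + 9" by (simp add: r_def)
  \<comment> \<open>For \<open>t = 15\<close> the root is \<open>sqrt 69\<close>, slightly above \<open>8.3\<close>.\<close>
  have "sqrt ((82/10)\<^sup>2) \<le> r"
    unfolding r_def using t by (intro real_sqrt_le_mono) (simp add: power2_eq_square)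
  then have r: "82/10 \<le> r" by simp
  have "p \<le> 2 / (r - 1)" using p by (simp add: p0_def r_def)
  then have pr: "p * (r - 1) \<le> 2" using r by (simp add: pos_le_divide_eq)
  have "p * (72/10) \<le> p * (r - 1)" using p r by (intro mult_left_mono) auto
  with pr show "p \<le> 28/100" by linarith
  have "(p * r) * (p * r) \<le> (2 + p) * (2 + p)"
  proof -
    have "p * r \<le> 2 + p" using pr by (simp add: algebra_simps)
    then show ?thesis using p r by (intro mult_mono) auto
  qed
  also have "(p * r) * (p * r) = p\<^sup>2 * r\<^sup>2" by (simp add: power2_eq_square)
  finally show "real t * p\<^sup>2 \<le> (1 - p) * (1 + 2 * p)"
    unfolding r2 by (simp add: power2_eq_square algebra_simps)
qed

section \<open>The measure gap\<close>

text \<open>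
  Take a walk \<open>F\<close> of the family that is at height at least \<open>t\<close> only once. Since it climbs by single
  steps, it is at height exactly \<open>t\<close> then, at a time \<open>t + 3 * s\<close>, and at all other times it is
  strictly below. For two copies of \<open>F\<close> and any \<open>A\<close> the triple inequality says that at some time
  \<open>k\<close> the three heights add up to at least \<open>3 * t\<close>. At the exceptional time this gives
  \<open>missed 0 k A \<le> s\<close>; at any other time each copy of \<open>F\<close> is at least one unit short of \<open>t\<close>, so that
  \<open>A\<close> is at height at least \<open>t + 2\<close>.
\<close>

lemma hits_at_common_position:
  assumes triple: "\<And>A B C. A \<in> \<G> \<Longrightarrow> B \<in> \<G> \<Longrightarrow> C \<in> \<G> \<Longrightarrow>
      \<exists>k\<in>{t..n}. missed 0 k A + missed 0 k B + missed 0 k C + t \<le> k"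
    and F: "F \<in> \<G>" "\<not> hits_twice 3 0 n t F" and t: "1 \<le> t"
  obtains s where "t + 3 * s \<le> n"
    and "\<And>A. A \<in> \<G> \<Longrightarrow> missed 0 (t + 3 * s) A \<le> s \<or> hits 3 0 n (t + 2) A"
proof -
  obtain k0 where k0: "k0 \<in> {t..n}" "t + 3 * missed 0 k0 F \<le> k0"
    using triple[OF F(1) F(1) F(1)] by force
  have other: "k < t + 3 * missed 0 k F" if "k \<le> n" "k \<noteq> k0" for k
  proof (rule ccontr)
    assume "\<not> ?thesis"
    then have "hits_twice 3 0 n t F"
      unfolding hits_twice_def using k0 that by (cases k k0 rule: linorder_cases) force+
    with F show False by simp
  qed
  \<comment> \<open>If \<open>F\<close> were above \<open>t\<close> at time \<open>k0\<close>, it would already be at \<open>t\<close> one step earlier.\<close>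
  have "missed 0 (k0 - 1) F \<le> missed 0 k0 F" by (rule missed_mono) simp
  moreover have "k0 - 1 < t + 3 * missed 0 (k0 - 1) F" by (rule other) (use k0 t in auto)
  ultimately have eq: "k0 = t + 3 * missed 0 k0 F" using k0 by linarith
  show thesis
  proof (rule that[of "missed 0 k0 F"])
    show "t + 3 * missed 0 k0 F \<le> n" using eq k0 by simp
    fix A assume "A \<in> \<G>"
    from triple[OF F(1) F(1) this] obtain k
      where k: "k \<in> {t..n}" "missed 0 k F + missed 0 k F + missed 0 k A + t \<le> k" by blast
    show "missed 0 (t + 3 * missed 0 k0 F) A \<le> missed 0 k0 F \<or> hits 3 0 n (t + 2) A"
    proof (cases "k = k0")
      case True
      then show ?thesis using k eq by simp
    next
      case False
      with k have "k < t + 3 * missed 0 k F" by (intro other) auto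
      with k have "t + 2 + 3 * missed 0 k A + 0 \<le> k" by simp
      with k show ?thesis unfolding hits_def by auto
    qed
  qed
qed

lemma prob_hits_2_le:
  fixes p :: real
  assumes p: "0 < p" "p < 1" "p \<le> 1 - p" and "a \<le> n"
  shows "prob p {a<..n} (hits 2 a n 1) \<le> p / (1 - p)"
proof -
  define c where "c = p / (1 - p)"
  have "p = (1 - p) * c" using p by (simp add: c_def)
  then have "(1 - p) * c\<^sup>2 = p * c" by (simp add: power2_eq_square)
  with \<open>p = (1 - p) * c\<close> have "p + (1 - p) * c\<^sup>2 = c" by (simp add: algebra_simps)
  then have "p + (1 - p) * (p / (1 - p))\<^sup>2 = p / (1 - p)" unfolding c_def .
  then show ?thesis using prob_hits_le[of p "p / (1 - p)" 2 a n 1] p by simp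
qed

lemma prob_full_prefix_hits_le:
  assumes p: "0 < p" "p \<le> 1/2" and n: "t \<le> n"
  shows "prob p {0<..n} (\<lambda>A. missed 0 t A = 0 \<and> hits 2 t n 1 A) \<le> p ^ t * (p / (1 - p))"
proof -
  have "prob p {0<..n} (\<lambda>A. missed 0 t A = 0 \<and> hits 2 t n 1 A)
      = p ^ t * prob p {t<..n} (hits 2 t n 1)"
    by (subst prob_interval_indep[of 0 t n]) (use n in \<open>auto simp: prob_missed_eq\<close>)
  also have "\<dots> \<le> p ^ t * (p / (1 - p))"
    using p n by (intro mult_left_mono prob_hits_2_le) auto
  finally show ?thesis .
qed

text \<open>
  Sets missing nothing up to \<open>t\<close> contribute little, because they miss at most one of the next three points.
  The main part misses one point up to \<open>t\<close>; it is confined by the condition on the tail, which costs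
  a factor of \<open>p / (1 - p)\<close>.
\<close>

lemma prob_near_frankl_1_le:
  fixes p :: real
  assumes p: "0 < p" "p \<le> 1/2" and n: "t + 3 \<le> n" and t: "1 \<le> t"
  shows "prob p {0<..n} (\<lambda>A. (missed 0 t A = 0 \<and> missed t (t + 3) A \<le> 1)
      \<or> (missed 0 t A = 1 \<and> missed t (t + 3) A = 0 \<and> hits 2 (t + 3) n 1 A))
    \<le> p ^ t * (3 * p\<^sup>2 - 2 * p ^ 3 + real t * p ^ 3)"
proof -
  let ?E = "\<lambda>A. missed 0 t A = 0 \<and> missed t (t + 3) A \<le> Suc 0"
  let ?F = "\<lambda>A. missed 0 t A = 1 \<and> missed t (t + 3) A = 0 \<and> hits 2 (t + 3) n 1 A"
  have z: "prob p {t<..t + 3} (\<lambda>A. missed t (t + 3) A = 0) = p ^ 3"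
    by (simp add: prob_missed_eq)
  have "prob p {t<..n} (\<lambda>A. missed t (t + 3) A \<le> Suc 0) = prob p {t<..t + 3} (\<lambda>A. missed t (t + 3) A \<le> Suc 0)"
    using n by (intro prob_prefix) simp
  also have "\<dots> = p ^ 3 + 3 * p\<^sup>2 * (1 - p)"
    unfolding prob_missed_le_Suc using z by (simp add: prob_missed_eq numeral_eq_Suc)
  finally have head: "prob p {t<..n} (\<lambda>A. missed t (t + 3) A \<le> Suc 0) = p ^ 3 + 3 * p\<^sup>2 * (1 - p)" .
  have E: "prob p {0<..n} ?E = p ^ t * (p ^ 3 + 3 * p\<^sup>2 * (1 - p))"
    by (subst prob_interval_indep[of 0 t n]) (use n in \<open>auto simp: prob_missed_eq head[simplified]\<close>)
  have tail: "prob p {t<..n} (\<lambda>A. missed t (t + 3) A = 0 \<and> hits 2 (t + 3) n 1 A)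
      = p ^ 3 * prob p {t + 3<..n} (hits 2 (t + 3) n 1)"
    by (subst prob_interval_indep[of t "t + 3" n]) (use n in \<open>auto simp: z\<close>)
  have "prob p {0<..n} ?F = prob p {0<..t} (\<lambda>A. missed 0 t A = 1) *
      prob p {t<..n} (\<lambda>A. missed t (t + 3) A = 0 \<and> hits 2 (t + 3) n 1 A)"
    by (rule prob_interval_indep) (use n in \<open>simp_all\<close>)
  also have "\<dots> = (real t * (1 - p) * p ^ (t - 1)) * (p ^ 3 * prob p {t + 3<..n} (hits 2 (t + 3) n 1))"
    unfolding tail by (simp add: prob_missed_eq)
  also have "\<dots> \<le> (real t * (1 - p) * p ^ (t - 1)) * (p ^ 3 * (p / (1 - p)))"
    using p n by (intro mult_left_mono prob_hits_2_le) auto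
  also have "\<dots> = p ^ t * (real t * p ^ 3)"
    using t p by (cases t) auto
  finally have F: "prob p {0<..n} ?F \<le> p ^ t * (real t * p ^ 3)" .
  have "prob p {0<..n} (\<lambda>A. ?E A \<or> ?F A) \<le> prob p {0<..n} ?E + prob p {0<..n} ?F"
    using p by (intro prob_disj_le) auto
  also have "\<dots> \<le> p ^ t * (p ^ 3 + 3 * p\<^sup>2 * (1 - p)) + p ^ t * (real t * p ^ 3)"
    unfolding E by (intro add_left_mono F)
  also have "\<dots> = p ^ t * (3 * p\<^sup>2 - 2 * p ^ 3 + real t * p ^ 3)"
    by (simp add: power2_eq_square power3_eq_cube algebra_simps)
  finally show ?thesis by simp
qed

text \<open>
  If every walk is at height at least \<open>t\<close> twice, the hitting estimate gives the bound. Otherwise all sets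
  not reaching height \<open>t + 2\<close> have at most \<open>s\<close> missing elements up to \<open>t + 3 * s\<close> for a common \<open>s\<close>, and
  reaching \<open>t + 2\<close> has probability at most \<open>exp 1 * b\<^sup>2 * p ^ t\<close>, about a quarter of \<open>p ^ t\<close> at worst. It
  remains to keep the sets of the first kind below \<open>745/1000 * p ^ t\<close>. For \<open>s \<ge> 2\<close> the Frankl family
  itself is that light. For \<open>s \<le> 1\<close> a set \<open>A0\<close> outside the Frankl family confines nearly
  all members \<open>B\<close> inside it: the triple \<open>B\<close>, \<open>B\<close>, \<open>A0\<close> forces the tail of \<open>B\<close> to contain more than half of
  some initial segment, which has probability at most \<open>p / (1 - p)\<close>.
\<close>

lemma measure_gap:
  fixes p :: real
  assumes p: "0 < p" "p \<le> 28/100" and tp: "real t * p\<^sup>2 \<le> (1 - p) * (1 + 2 * p)"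
    and t: "1 \<le> t" "t \<le> n"
    and triple: "\<And>A B C. A \<in> \<G> \<Longrightarrow> B \<in> \<G> \<Longrightarrow> C \<in> \<G> \<Longrightarrow>
      \<exists>k\<in>{t..n}. missed 0 k A + missed 0 k B + missed 0 k C + t \<le> k"
    and not0: "\<exists>A\<in>\<G>. 0 < missed 0 t A"
    and not1: "t + 3 \<le> n \<Longrightarrow> \<exists>A\<in>\<G>. 1 < missed 0 (t + 3) A"
  shows "prob p {0<..n} (\<lambda>A. A \<in> \<G>) \<le> 99/100 * p ^ t"
proof -
  have p01: "0 \<le> p" "p \<le> 1" "p \<le> 1/2" using p by auto
  from hitting_root_exists[OF p] obtain b
    where b: "0 < b" "b \<le> 3/10" "(1 - p) * (1 + b + b\<^sup>2) = 1" .
  have bt: "b ^ t \<le> 272/100 * p ^ t" using hitting_root_power_le[OF b(1,3) p(1) _ tp] p by simp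
  have step: "p + (1 - p) * b ^ 3 \<le> b" using hitting_root(2)[OF b(3)] by simp
  have "b * b \<le> 3/10 * (3/10)" using b by (intro mult_mono) auto
  then have bb: "b\<^sup>2 \<le> 9/100" by (simp add: power2_eq_square)
  show ?thesis
  proof (cases "\<forall>F\<in>\<G>. hits_twice 3 0 n t F")
    case True
    have "prob p {0<..n} (\<lambda>A. A \<in> \<G>) \<le> prob p {0<..n} (hits_twice 3 0 n t)"
      using True by (intro prob_mono[OF p01(1,2)]) auto
    also have "\<dots> \<le> b ^ t * (p + (1 - p) * b\<^sup>2)"
      using prob_hits_twice_le[OF p01(1,2), of b 2 0 n t] b step by (simp add: numeral_eq_Suc)
    also have "\<dots> \<le> 272/100 * p ^ t * (3448/10000)"
    proof (rule mult_mono[OF bt])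
      have "p + (1 - p) * b\<^sup>2 \<le> p + (1 - p) * (9/100)"
        using bb p by (intro add_left_mono mult_left_mono) auto
      also have "\<dots> = 91/100 * p + 9/100" by (simp add: field_simps)
      also have "\<dots> \<le> 3448/10000" using p by simp
      finally show "p + (1 - p) * b\<^sup>2 \<le> 3448/10000" .
    qed (use p in auto)
    also have "\<dots> \<le> 99/100 * p ^ t" using p by simp
    finally show ?thesis .
  next
    case False
    then obtain F where "F \<in> \<G>" "\<not> hits_twice 3 0 n t F" by blast
    from hits_at_common_position[OF triple this t(1)] obtain s where s: "t + 3 * s \<le> n"
      and hit: "\<And>A. A \<in> \<G> \<Longrightarrow> missed 0 (t + 3 * s) A \<le> s \<or> hits 3 0 n (t + 2) A" by blast
    have far: "prob p {0<..n} (hits 3 0 n (t + 2)) \<le> 2448/10000 * p ^ t"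
    proof -
      have "prob p {0<..n} (hits 3 0 n (t + 2)) \<le> b ^ (t + 2)"
        using b step by (intro prob_hits_le p01) auto
      also have "\<dots> = b ^ t * b\<^sup>2" by (simp add: power_add power2_eq_square)
      also have "\<dots> \<le> 272/100 * p ^ t * (9/100)" using bt bb p b by (intro mult_mono) auto
      also have "\<dots> = 2448/10000 * p ^ t" by simp
      finally show ?thesis .
    qed
    have reduce: ?thesis
      if near: "\<And>A. A \<in> \<G> \<Longrightarrow> missed 0 (t + 3 * s) A \<le> s \<Longrightarrow> P A"
        and P: "prob p {0<..n} P \<le> 745/1000 * p ^ t" for P
    proof -
      have "prob p {0<..n} (\<lambda>A. A \<in> \<G>) \<le> prob p {0<..n} (\<lambda>A. P A \<or> hits 3 0 n (t + 2) A)"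
        using hit near by (intro prob_mono[OF p01(1,2)]) auto
      also have "\<dots> \<le> prob p {0<..n} P + prob p {0<..n} (hits 3 0 n (t + 2))"
        by (rule prob_disj_le[OF p01(1,2)]) simp
      also have "\<dots> \<le> 745/1000 * p ^ t + 2448/10000 * p ^ t" by (rule add_mono[OF P far])
      also have "\<dots> \<le> 99/100 * p ^ t" using p by simp
      finally show ?thesis .
    qed
    consider "s = 0" | "s = 1" | "2 \<le> s" by linarith
    then show ?thesis
    proof cases
      case 1
      from not0 obtain A0 where A0: "A0 \<in> \<G>" "0 < missed 0 t A0" by blast
      show ?thesis
      proof (rule reduce[of "\<lambda>A. missed 0 t A = 0 \<and> hits 2 t n 1 A"])
        fix B assume B: "B \<in> \<G>" "missed 0 (t + 3 * s) B \<le> s"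
        from triple[OF B(1) B(1) A0(1)] obtain k where
          k: "k \<in> {t..n}" "missed 0 k B + missed 0 k B + missed 0 k A0 + t \<le> k" by blast
        have "0 < missed 0 k A0" using A0(2) missed_mono[of t k 0 A0] k by auto
        moreover have "missed t k B \<le> missed 0 k B" using missed_split[of 0 t k B] k by simp
        ultimately have "1 + 2 * missed t k B + t \<le> k" using k by linarith
        then show "missed 0 t B = 0 \<and> hits 2 t n 1 B"
          using B 1 k unfolding hits_def by auto
      next
        have "p / (1 - p) \<le> 745/1000" using p by (simp add: divide_le_eq)
        then have "p ^ t * (p / (1 - p)) \<le> p ^ t * (745/1000)" using p by (intro mult_left_mono) auto
        with prob_full_prefix_hits_le[OF p(1) p01(3) t(2)]
        have "prob p {0<..n} (\<lambda>A. missed 0 t A = 0 \<and> hits 2 t n 1 A) \<le> p ^ t * (745/1000)"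
          by (rule order_trans)
        then show "prob p {0<..n} (\<lambda>A. missed 0 t A = 0 \<and> hits 2 t n 1 A) \<le> 745/1000 * p ^ t"
          by (simp only: mult.commute)
      qed
    next
      case 2
      with s have n: "t + 3 \<le> n" by simp
      from not1[OF n] obtain A0 where A0: "A0 \<in> \<G>" "1 < missed 0 (t + 3) A0" by blast
      let ?P = "\<lambda>A. (missed 0 t A = 0 \<and> missed t (t + 3) A \<le> 1)
        \<or> (missed 0 t A = 1 \<and> missed t (t + 3) A = 0 \<and> hits 2 (t + 3) n 1 A)"
      show ?thesis
      proof (rule reduce[of ?P])
        fix B assume B: "B \<in> \<G>" "missed 0 (t + 3 * s) B \<le> s"
        have sp: "missed 0 t B + missed t (t + 3) B \<le> 1"
          using B 2 missed_split[of 0 t "t + 3" B] by simp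
        show "?P B"
        proof (cases "missed 0 t B = 0")
          case True
          with sp show ?thesis by simp
        next
          case False
          with sp have B1: "missed 0 t B = 1" "missed t (t + 3) B = 0" by auto
          from triple[OF B(1) B(1) A0(1)] obtain k where
            k: "k \<in> {t..n}" "missed 0 k B + missed 0 k B + missed 0 k A0 + t \<le> k" by blast
          have kB: "1 \<le> missed 0 k B" using B1 missed_mono[of t k 0 B] k by auto
          \<comment> \<open>Up to \<open>t + 3\<close> the two copies of \<open>B\<close> and \<open>A0\<close> together miss too many points.\<close>
          have "t + 3 < k"
          proof (rule ccontr)
            assume "\<not> t + 3 < k"
            then have "missed 0 (t + 3) A0 = missed 0 k A0 + missed k (t + 3) A0"
              by (intro missed_split) auto
            moreover have "missed k (t + 3) A0 \<le> t + 3 - k" by (rule missed_le)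
            ultimately show False using A0(2) k kB \<open>\<not> t + 3 < k\<close> by linarith
          qed
          moreover have "missed 0 (t + 3) A0 \<le> missed 0 k A0"
            using calculation by (intro missed_mono) simp
          moreover have "missed 0 k B = 1 + missed (t + 3) k B"
            using calculation(1) missed_split[of 0 t k B] missed_split[of t "t + 3" k B] B1 by simp
          ultimately have "1 + 2 * missed (t + 3) k B + (t + 3) \<le> k" using A0(2) k by linarith
          then show ?thesis using B1 k \<open>t + 3 < k\<close> unfolding hits_def by auto
        qed
      next
        have "3 * p\<^sup>2 - 2 * p ^ 3 + real t * p ^ 3 \<le> 745/1000"
        proof -
          have "real t * p ^ 3 = (real t * p\<^sup>2) * p" by (simp add: power2_eq_square power3_eq_cube)
          also have "\<dots> \<le> (1 - p) * (1 + 2 * p) * p" using tp p by (intro mult_right_mono) auto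
          also have "\<dots> = p + p\<^sup>2 - 2 * p ^ 3"
            by (simp add: power2_eq_square power3_eq_cube algebra_simps)
          finally have "3 * p\<^sup>2 - 2 * p ^ 3 + real t * p ^ 3 \<le> p + 4 * p\<^sup>2 - 4 * p ^ 3" by simp
          also have "\<dots> \<le> p + 4 * p\<^sup>2" using p by simp
          finally have "3 * p\<^sup>2 - 2 * p ^ 3 + real t * p ^ 3 \<le> p + 4 * p\<^sup>2" .
          moreover have "p\<^sup>2 \<le> 28/100 * (28/100)"
            unfolding power2_eq_square using p by (intro mult_mono) auto
          ultimately show ?thesis using p by simp
        qed
        then have "p ^ t * (3 * p\<^sup>2 - 2 * p ^ 3 + real t * p ^ 3) \<le> p ^ t * (745/1000)"
          using p by (intro mult_left_mono) auto
        with prob_near_frankl_1_le[OF p(1) p01(3) n t(1)]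
        show "prob p {0<..n} ?P \<le> 745/1000 * p ^ t" by simp
      qed
    next
      case 3
      show ?thesis
      proof (rule reduce[of "\<lambda>A. missed 0 (t + 3 * s) A \<le> s"])
        have "prob p {0<..n} (\<lambda>A. missed 0 (t + 3 * s) A \<le> s) = frankl_measure p t s"
          by (rule prob_prefix[OF s])
        also have "\<dots> \<le> frankl_measure p t 2" by (rule frankl_measure_antimono[OF p01(1,3) tp 3])
        also have "\<dots> \<le> 74/100 * p ^ t" by (rule frankl_measure_2_le[OF p tp])
        also have "\<dots> \<le> 745/1000 * p ^ t" using p by simp
        finally show "prob p {0<..n} (\<lambda>A. missed 0 (t + 3 * s) A \<le> s) \<le> 745/1000 * p ^ t" .
      qed
    qed
  qed
qed

section \<open>Stability\<close>

lemma biased_measure_eq_prob: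
  assumes "\<G> \<subseteq> Pow {1..n}"
  shows "biased_measure n p \<G> = prob p {0<..n} (\<lambda>A. A \<in> \<G>)"
proof -
  have I: "{0<..n} = {1..n}" by auto
  have "{A \<in> Pow {0<..n}. A \<in> \<G>} = \<G>" using assms I by auto
  moreover have "p ^ card A * (1 - p) ^ (n - card A) = (\<Prod>i\<in>{0<..n}. if i \<in> A then p else 1 - p)"
    if "A \<in> \<G>" for A
  proof -
    from that assms have A: "A \<subseteq> {1..n}" by auto
    then have "{1..n} \<inter> {i. i \<in> A} = A" "{1..n} \<inter> - {i. i \<in> A} = {1..n} - A" by auto
    moreover have "card ({1..n} - A) = n - card A"
      using A by (subst card_Diff_subset) (auto intro: finite_subset)
    ultimately show ?thesis unfolding I by (simp add: prod.If_cases)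
  qed
  ultimately show ?thesis unfolding biased_measure_def prob_def by (intro sum.cong) auto
qed

lemma mem_frankl_family_iff:
  "F \<in> frankl_family n t s \<longleftrightarrow> F \<subseteq> {1..n} \<and> missed 0 (t + 3 * s) F \<le> s"
proof -
  have "card ({0<..t + 3 * s} - F) + card (F \<inter> {1..t + 3 * s}) = t + 3 * s"
  proof -
    have "{0<..t + 3 * s} = ({0<..t + 3 * s} - F) \<union> (F \<inter> {1..t + 3 * s})" by auto
    then have "card {0<..t + 3 * s} = card ({0<..t + 3 * s} - F) + card (F \<inter> {1..t + 3 * s})"
      by (metis (no_types, lifting) card_Un_disjoint finite_Diff finite_Int finite_atLeastAtMost
          finite_greaterThanAtMost Diff_disjoint Int_assoc Int_commute inf_bot_right)
    then show ?thesis by simp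
  qed
  then show ?thesis unfolding frankl_family_def missed_def by auto
qed

lemma biased_measure_frankl_family:
  assumes "t + 3 * s \<le> n"
  shows "biased_measure n p (frankl_family n t s) = frankl_measure p t s"
proof -
  have "biased_measure n p (frankl_family n t s) = prob p {0<..n} (\<lambda>A. A \<in> frankl_family n t s)"
    by (rule biased_measure_eq_prob) (auto simp: frankl_family_def)
  also have "\<dots> = prob p {0<..n} (\<lambda>A. missed 0 (t + 3 * s) A \<le> s)"
    by (rule prob_cong) (auto simp: mem_frankl_family_iff)
  also have "\<dots> = frankl_measure p t s" by (rule prob_prefix[OF assms])
  finally show ?thesis .
qed

lemma sym_diff_subfamily:
  assumes sub: "\<G> \<subseteq> frankl_family n t s"
    and le: "biased_measure n p (frankl_family n t s) \<le> m" "biased_measure n p \<G> = m - \<epsilon>"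
  shows "biased_measure n p (sym_diff (frankl_family n t s) \<G>) \<le> \<epsilon>"
proof -
  have "finite (frankl_family n t s)"
    by (rule finite_subset[of _ "Pow {1..n}"]) (auto simp: frankl_family_def)
  then have "biased_measure n p (frankl_family n t s - \<G>)
      = biased_measure n p (frankl_family n t s) - biased_measure n p \<G>"
    unfolding biased_measure_def using sub by (intro sum_diff)
  moreover have "sym_diff (frankl_family n t s) \<G> = frankl_family n t s - \<G>" using sub by auto
  ultimately show ?thesis using le by simp
qed

theorem theorem2:
  fixes t :: nat and p :: real
  assumes "t \<ge> 15" and "0 < p" and "p \<le> p0 t"
  shows "\<exists>\<epsilon>\<^sub>0>0. \<exists>C>0. \<forall>(\<epsilon>::real) (n::nat) (\<G>::nat set set).
           0 < \<epsilon> \<and> \<epsilon> < \<epsilon>\<^sub>0 \<and> n \<ge> t \<and> \<G> \<subseteq> Pow {1..n} \<and>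
           shifted n \<G> \<and> three_wise_intersecting t \<G> \<and>
           biased_measure n p \<G> = p ^ t - \<epsilon> \<longrightarrow>
           (\<exists>s\<in>{0, 1}. t + 3 * s \<le> n \<and>
              biased_measure n p (sym_diff (frankl_family n t s) \<G>) < C * \<epsilon>)"
proof -
  note p = p0_bounds[OF assms]
  have "\<exists>s\<in>{0, 1}. t + 3 * s \<le> n \<and>
      biased_measure n p (sym_diff (frankl_family n t s) \<G>) < 2 * \<epsilon>"
    if eps: "0 < \<epsilon>" "\<epsilon> < p ^ t / 100" and n: "t \<le> n" and sub: "\<G> \<subseteq> Pow {1..n}"
      and sh: "shifted n \<G>" and int: "three_wise_intersecting t \<G>"
      and m: "biased_measure n p \<G> = p ^ t - \<epsilon>" for \<epsilon> n \<G>
  proof -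
    have "\<exists>s\<in>{0, 1}. t + 3 * s \<le> n \<and> \<G> \<subseteq> frankl_family n t s"
    proof (rule ccontr)
      assume no: "\<not> ?thesis"
      have out: "\<exists>A\<in>\<G>. s < missed 0 (t + 3 * s) A" if "s \<in> {0, 1}" "t + 3 * s \<le> n" for s
      proof -
        have "\<not> \<G> \<subseteq> frankl_family n t s" using no that by blast
        then obtain A where "A \<in> \<G>" "A \<notin> frankl_family n t s" by blast
        with sub show ?thesis by (auto simp: mem_frankl_family_iff not_le)
      qed
      have "prob p {0<..n} (\<lambda>A. A \<in> \<G>) \<le> 99/100 * p ^ t"
      proof (rule measure_gap[OF assms(2) p])
        show "\<exists>k\<in>{t..n}. missed 0 k A + missed 0 k B + missed 0 k C + t \<le> k"
          if "A \<in> \<G>" "B \<in> \<G>" "C \<in> \<G>" for A B C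
          using assms(1) that by (intro three_missed_bound[OF sh sub int _ n]) auto
      qed (use assms(1) n out[of 0] out[of 1] in auto)
      then show False using m eps biased_measure_eq_prob[OF sub] by simp
    qed
    then obtain s where s: "s \<in> {0, 1}" "t + 3 * s \<le> n" "\<G> \<subseteq> frankl_family n t s" by blast
    have "frankl_measure p t s \<le> frankl_measure p t 0"
      using assms(2) p by (intro frankl_measure_antimono) auto
    then have "biased_measure n p (frankl_family n t s) \<le> p ^ t"
      unfolding biased_measure_frankl_family[OF s(2)] frankl_measure_0 .
    from sym_diff_subfamily[OF s(3) this m]
    have "biased_measure n p (sym_diff (frankl_family n t s) \<G>) < 2 * \<epsilon>" using eps by simp
    with s show ?thesis by blast
  qed
  moreover have "0 < p ^ t / 100" "(0::real) < 2" using assms by simp_all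
  ultimately show ?thesis by blast
qed

end
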